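(* Let $d$ and $s$ be integers with $1\le s\le d/2$. There exists $n_0=n_0(d,s)$ such that for all $n\ge n_0$ the following holds. Suppose $\mathcal F\subseteq \binom{[n]}{d+1}$ is an $s$-witness family. Then $|\mathcal F|\le \binom{n-1}{d}$. Moreover, if $|\mathcal F|=\binom{n-1}{d}$, then $\mathcal F$ is a star, i.e. there is an element $x\in[n]$ contained in every member of $\mathcal F$.
   Context: $[n]=\{1,\dots,n\}$ and $\binom{[n]}{d+1}$ denotes the family of all $(d+1)$-element subsets of $[n]$. For $n\ge d+1$ and $0\le s\le d$, a family $\mathcal F\subseteq\binom{[n]}{d+1}$ is an $s$-witness family if for every $F\in\mathcal F$ there exists $B_F\subseteq F$ with $|B_F|=s$ such that $F\cap F'\neq B_F$ for every $F'\in\mathcal F$. *)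

theory Defs
  imports Main
begin

definition s_witness_family :: "nat \<Rightarrow> nat \<Rightarrow> nat \<Rightarrow> nat set set \<Rightarrow> bool" where
  "s_witness_family n d s \<F> \<longleftrightarrow>
     \<F> \<subseteq> {A. A \<subseteq> {1..n} \<and> card A = d + 1} \<and>
     (\<forall>F\<in>\<F>. \<exists>B. B \<subseteq> F \<and> card B = s \<and> (\<forall>F'\<in>\<F>. F \<inter> F' \<noteq> B))"

end

theory Submission
  imports Defs Complex_Main
begin

text \<open>
  Call an \<open>s\<close>-set \<open>B\<close> centred if some \<open>y \<notin> B\<close> lies in every member of the family containing \<open>B\<close>.
  Members with witness \<open>B\<close> pairwise intersect outside \<open>B\<close>; if \<open>B\<close> is not centred, every such
  member contains one of boundedly many pairs disjoint from \<open>B\<close>, so there are only \<open>O(n^(d-s-1))\<close>.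
  On the remaining members, deleting the centre of the witness is injective into the \<open>d\<close>-sets. If
  the family is at least as large as a star, all but \<open>O(n^(d-1))\<close> of the \<open>d\<close>-sets are hit, and a
  \<open>d\<close>-set that is hit cannot contain two centred \<open>s\<close>-sets whose centres are distinct and outside
  it; since \<open>2s \<le> d\<close>, a positive proportion \<open>E\<close> of all \<open>s\<close>-sets has the same centre \<open>x\<close>.

  Suppose some members avoid \<open>x\<close>, with \<open>b\<close> distinct witnesses. Let \<open>U\<close> be the \<open>d\<close>-sets avoiding \<open>x\<close>
  and containing such a witness. All but \<open>O(b n^(d-s-1))\<close> of the sets \<open>G \<union> {x}\<close>, \<open>G \<in> U\<close>, are missing
  from the family, whereas the members avoiding \<open>x\<close> inject, up to \<open>O(b n^(d-s-1))\<close> exceptions, into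
  those \<open>G \<in> U\<close> that contain no element of \<open>E\<close>. As \<open>2s \<le> d\<close>, at least \<open>c b n^(d-s)\<close> elements of \<open>U\<close>
  do contain one, so the family is smaller than a star.
\<close>

section \<open>Counting sets above a fixed set\<close>

lemma card_supersets_le:
  assumes "finite V" "card V = n" "finite A"
  shows "card {X. X \<subseteq> V \<and> card X = j \<and> A \<subseteq> X} \<le> n ^ (j - card A)"
proof -
  let ?Y = "{Y. Y \<subseteq> V \<and> card Y = j - card A}"
  have "card {X. X \<subseteq> V \<and> card X = j \<and> A \<subseteq> X} \<le> card ?Y"
  proof (rule card_inj_on_le[where f = "\<lambda>X. X - A"])
    show "inj_on (\<lambda>X. X - A) {X. X \<subseteq> V \<and> card X = j \<and> A \<subseteq> X}"
      by (auto simp: inj_on_def)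
    show "(\<lambda>X. X - A) ` {X. X \<subseteq> V \<and> card X = j \<and> A \<subseteq> X} \<subseteq> ?Y"
      using assms by (auto simp: card_Diff_subset)
  qed (use assms in auto)
  also have "\<dots> = n choose (j - card A)"
    using n_subsets assms by metis
  also have "\<dots> \<le> n ^ (j - card A)"
    by (cases "j - card A \<le> n") (auto simp: binomial_le_pow binomial_eq_0)
  finally show ?thesis .
qed

lemma card_supersets_ge:
  assumes "finite V" "card V = n" "A \<subseteq> V" "finite T" "A \<inter> T = {}" "card A \<le> j" "2 * (j + card T) \<le> n"
  shows "(real n / real (2 * j)) ^ (j - card A)
    \<le> real (card {X. X \<subseteq> V \<and> card X = j \<and> A \<subseteq> X \<and> X \<inter> T = {}})"
proof -
  define m where "m = card (V - A - T)"
  let ?i = "j - card A"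
  have fA: "finite A" using assms finite_subset by blast
  have "card V \<le> m + card (A \<union> T)"
    unfolding m_def by (intro order_trans[OF _ card_Un_le] card_mono) (use assms fA in auto)
  moreover have "card (A \<union> T) \<le> j + card T"
    using card_Un_le[of A T] assms(6) by linarith
  ultimately have "n \<le> m + (j + card T)" using assms(2) by linarith
  \<comment> \<open>At least half of \<open>V\<close> lies outside \<open>A\<close> and
    \<open>T\<close>; hence the denominator \<open>2 * j\<close> instead of
    \<open>j\<close>.\<close>
  hence m: "n \<le> 2 * m" using assms(7) by presburger
  hence im: "?i \<le> m" using assms(7) by presburger
  have "(real n / real (2 * j)) ^ ?i \<le> (real m / real ?i) ^ ?i"
  proof (cases "?i = 0")
    case False
    have "real n / real (2 * j) \<le> real (2 * m) / real (2 * ?i)"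
      by (intro frac_le) (use m False in auto)
    thus ?thesis by (intro power_mono) auto
  qed simp
  also have "\<dots> \<le> real (m choose ?i)"
    using im by (rule binomial_ge_n_over_k_pow_k)
  also have "m choose ?i = card {Y. Y \<subseteq> V - A - T \<and> card Y = ?i}"
    using assms by (simp add: n_subsets m_def)
  also have "\<dots> \<le> card {X. X \<subseteq> V \<and> card X = j \<and> A \<subseteq> X \<and> X \<inter> T = {}}"
  proof (rule card_inj_on_le[where f = "\<lambda>Y. A \<union> Y"])
    show "inj_on (\<lambda>Y. A \<union> Y) {Y. Y \<subseteq> V - A - T \<and> card Y = ?i}"
      by (auto simp: inj_on_def)
    have "card (A \<union> Y) = j" if "Y \<subseteq> V - A - T" "card Y = ?i" for Y
      using that assms(1,6) fA by (subst card_Un_disjoint) (auto intro: finite_subset)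
    thus "(\<lambda>Y. A \<union> Y) ` {Y. Y \<subseteq> V - A - T \<and> card Y = ?i}
        \<subseteq> {X. X \<subseteq> V \<and> card X = j \<and> A \<subseteq> X \<and> X \<inter> T = {}}"
      using assms(3,5) by blast
  qed (use assms in auto)
  finally show ?thesis by simp
qed

text \<open>Double counting of triples \<open>(A, B, G)\<close> with
  \<open>A \<union> B \<subseteq> G\<close>: each pair extends to order
  \<open>n ^ (r - 2 * s)\<close> sets \<open>G\<close> avoiding \<open>T A B\<close>, and each
  \<open>G\<close> contains at most \<open>4 ^ r\<close> pairs. In its uses, \<open>N\<close>
  consists of the \<open>d\<close>-sets that are not truncations, or of those that contain both a
  witness and a set of the dense class.\<close>

lemma card_disjoint_pairs_le:
  assumes V: "finite V" "card V = n" and r: "2 * s \<le> r" and n: "2 * (r + 2) \<le> n"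
    and P: "\<And>A B. (A, B) \<in> P \<Longrightarrow> A \<subseteq> V \<and> B \<subseteq> V \<and> card A = s \<and> card B = s \<and> A \<inter> B = {}"
    and T: "\<And>A B. (A, B) \<in> P \<Longrightarrow> finite (T A B) \<and> card (T A B) \<le> 2 \<and> (A \<union> B) \<inter> T A B = {}"
    and N: "N \<subseteq> {G. G \<subseteq> V \<and> card G = r}"
    and PN: "\<And>A B G. (A, B) \<in> P \<Longrightarrow> G \<subseteq> V \<Longrightarrow> card G = r \<Longrightarrow> A \<union> B \<subseteq> G \<Longrightarrow>
               G \<inter> T A B = {} \<Longrightarrow> G \<in> N"
  shows "real (card P) * real n ^ (r - 2 * s) \<le> real (8 * r) ^ r * real (card N)"
proof -
  have finP: "finite P"
    by (rule finite_subset[of _ "Pow V \<times> Pow V"]) (use P V in \<open>fast, simp\<close>)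
  have finN: "finite N"
    by (rule finite_subset[OF N]) (use V in auto)
  let ?S = "SIGMA p:P. {G \<in> N. fst p \<union> snd p \<subseteq> G}"
  have lower: "(real n / real (2 * r)) ^ (r - 2 * s) \<le> real (card {G \<in> N. fst p \<union> snd p \<subseteq> G})"
    if "p \<in> P" for p
  proof -
    obtain A B where p: "p = (A, B)" by (cases p)
    note PAB = P[OF that[unfolded p]] and TAB = T[OF that[unfolded p]]
    have "finite A" "finite B" using PAB V finite_subset by blast+
    hence cAB: "card (A \<union> B) = 2 * s" using PAB by (simp add: card_Un_disjoint)
    have "(real n / real (2 * r)) ^ (r - card (A \<union> B))
      \<le> real (card {X. X \<subseteq> V \<and> card X = r \<and> A \<union> B \<subseteq> X \<and> X \<inter> T A B = {}})"
      by (rule card_supersets_ge) (use PAB TAB V r n cAB in auto)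
    also have "\<dots> \<le> real (card {G \<in> N. fst p \<union> snd p \<subseteq> G})"
      unfolding of_nat_le_iff
      by (rule card_mono) (use finN PN[OF that[unfolded p]] p in auto)
    finally show ?thesis by (simp add: cAB)
  qed
  have "real (card P) * (real n / real (2 * r)) ^ (r - 2 * s)
    \<le> (\<Sum>p\<in>P. real (card {G \<in> N. fst p \<union> snd p \<subseteq> G}))"
    using sum_bounded_below[of P, OF lower] by simp
  also have "\<dots> = real (card ?S)"
    using finP finN by (simp add: card_SigmaI)
  also have "card ?S \<le> card ((\<lambda>(G, p). (p, G)) ` (SIGMA G:N. Pow G \<times> Pow G))"
  proof (rule card_mono)
    have "finite G" if "G \<in> N" for G using that N V finite_subset by blast
    thus "finite ((\<lambda>(G, p). (p, G)) ` (SIGMA G:N. Pow G \<times> Pow G))"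
      using finN by auto
    show "?S \<subseteq> (\<lambda>(G, p). (p, G)) ` (SIGMA G:N. Pow G \<times> Pow G)"
      by force
  qed
  also have "\<dots> \<le> card (SIGMA G:N. Pow G \<times> Pow G)"
    by (rule card_image_le) (use finN N V in \<open>auto intro!: finite_SigmaI intro: finite_subset\<close>)
  also have "\<dots> = (\<Sum>G\<in>N. card (Pow G \<times> Pow G))"
    by (rule card_SigmaI) (use finN N V in \<open>auto intro!: finite_cartesian_product intro: finite_subset\<close>)
  also have "\<dots> = (\<Sum>G\<in>N. 4 ^ r)"
  proof (rule sum.cong[OF refl])
    fix G assume "G \<in> N"
    hence "card G = r" "finite G" using N V finite_subset by blast+
    thus "card (Pow G \<times> Pow G) = 4 ^ r"
      by (simp add: card_cartesian_product card_Pow flip: power_mult_distrib)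
  qed
  finally have le: "real (card P) * (real n / real (2 * r)) ^ (r - 2 * s) \<le> 4 ^ r * real (card N)"
    by (simp add: mult.commute)
  show ?thesis
  proof (cases "r = 0")
    case False
    have "real (card P) * real n ^ (r - 2 * s)
      = real (2 * r) ^ (r - 2 * s) * (real (card P) * (real n / real (2 * r)) ^ (r - 2 * s))"
      using False by (simp add: power_divide)
    \<comment> \<open>Enlarging the exponent to \<open>r\<close> lets both constants merge into
      \<open>(8 * r) ^ r\<close>.\<close>
    also have "\<dots> \<le> real (2 * r) ^ r * (4 ^ r * real (card N))"
      by (intro mult_mono le power_increasing) (use False in auto)
    also have "\<dots> = (real (2 * r) * 4) ^ r * real (card N)"
      by (simp only: power_mult_distrib mult.assoc)
    finally show ?thesis by simp
  qed (use le in simp)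
qed

section \<open>Centres of witnesses and truncation\<close>

locale witness_family =
  fixes V :: "'a set" and \<F> :: "'a set set" and W :: "'a set \<Rightarrow> 'a set" and d s n :: nat
  assumes finite_V: "finite V" and card_V: "card V = n"
    and members: "\<F> \<subseteq> {A. A \<subseteq> V \<and> card A = d + 1}"
    and W_subset: "F \<in> \<F> \<Longrightarrow> W F \<subseteq> F"
    and card_W: "F \<in> \<F> \<Longrightarrow> card (W F) = s"
    and W_avoid: "F \<in> \<F> \<Longrightarrow> F' \<in> \<F> \<Longrightarrow> F \<inter> F' \<noteq> W F"
    and s_pos: "1 \<le> s" and two_s: "2 * s \<le> d"
begin

text \<open>A set lying in no member is vacuously centred unless it contains \<open>V\<close>; its
  \<open>centre\<close> is then an arbitrary point of \<open>V\<close> outside it.\<close>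

definition centred :: "'a set \<Rightarrow> bool" where
  "centred B \<longleftrightarrow> (\<exists>y\<in>V - B. \<forall>F\<in>\<F>. B \<subseteq> F \<longrightarrow> y \<in> F)"

definition centre :: "'a set \<Rightarrow> 'a" where
  "centre B = (SOME y. y \<in> V - B \<and> (\<forall>F\<in>\<F>. B \<subseteq> F \<longrightarrow> y \<in> F))"

lemma centreD:
  assumes "centred B"
  shows "centre B \<in> V" "centre B \<notin> B" "F \<in> \<F> \<Longrightarrow> B \<subseteq> F \<Longrightarrow> centre B \<in> F"
proof -
  have "centre B \<in> V - B \<and> (\<forall>F\<in>\<F>. B \<subseteq> F \<longrightarrow> centre B \<in> F)"
    unfolding centre_def by (rule someI_ex) (use assms centred_def in auto)
  thus "centre B \<in> V" "centre B \<notin> B" "F \<in> \<F> \<Longrightarrow> B \<subseteq> F \<Longrightarrow> centre B \<in> F" by auto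
qed

lemma finite_family: "finite \<F>"
  by (rule finite_subset[OF members]) (use finite_V in auto)

lemma memberD:
  assumes "F \<in> \<F>"
  shows "F \<subseteq> V" "card F = d + 1" "finite F" "finite (W F)"
  using assms members finite_V W_subset[OF assms] by (auto intro: finite_subset)

text \<open>A member \<open>F\<close> with witness \<open>B\<close> meets every member containing
  \<open>B\<close> outside \<open>B\<close>. A fixed \<open>F0\<close> thus gives a point
  \<open>y\<close> of \<open>F\<close>; since \<open>y\<close> is not common to all members
  containing \<open>B\<close>, some \<open>T y\<close> omits it, and meeting \<open>T y\<close>
  gives a second point \<open>t \<noteq> y\<close>. So \<open>F\<close> contains one of at most
  \<open>(d + 1)\<^sup>2\<close> sets of size \<open>s + 2\<close>.\<close>

lemma card_uncentred_fibre:
  assumes "\<not> centred B"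
  shows "card {F \<in> \<F>. W F = B} \<le> (d + 1)\<^sup>2 * n ^ (d - s - 1)"
proof (cases "{F \<in> \<F>. W F = B} = {}")
  case False
  then obtain F0 where F0: "F0 \<in> \<F>" "W F0 = B" by blast
  have BF0: "B \<subseteq> F0" and cB: "card B = s" and fB: "finite B"
    using W_subset card_W memberD F0 by blast+
  have "\<exists>T. T \<in> \<F> \<and> B \<subseteq> T \<and> y \<notin> T" if "y \<in> F0 - B" for y
    using assms that memberD(1)[OF F0(1)] unfolding centred_def by blast
  then obtain T where T: "\<And>y. y \<in> F0 - B \<Longrightarrow> T y \<in> \<F> \<and> B \<subseteq> T y \<and> y \<notin> T y" by metis
  let ?S = "\<lambda>y t. {X. X \<subseteq> V \<and> card X = d + 1 \<and> insert y (insert t B) \<subseteq> X}"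
  have sub: "{F \<in> \<F>. W F = B} \<subseteq> (\<Union>y\<in>F0 - B. \<Union>t\<in>T y - B. ?S y t)"
  proof
    fix F assume "F \<in> {F \<in> \<F>. W F = B}"
    hence F: "F \<in> \<F>" "W F = B" by auto
    have BF: "B \<subseteq> F" using W_subset F by blast
    obtain y where y: "y \<in> F0 - B" "y \<in> F"
      using W_avoid[OF F(1) F0(1)] F(2) BF BF0 by blast
    obtain t where t: "t \<in> T y - B" "t \<in> F"
      using W_avoid[OF F(1), of "T y"] T[OF y(1)] F(2) BF by blast
    show "F \<in> (\<Union>y\<in>F0 - B. \<Union>t\<in>T y - B. ?S y t)"
      using y t BF memberD[OF F(1)] by auto
  qed
  have inner: "card (\<Union>t\<in>T y - B. ?S y t) \<le> (d + 1) * n ^ (d - s - 1)" if y: "y \<in> F0 - B" for y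
  proof -
    have Ty: "T y \<in> \<F>" "y \<notin> T y" using T[OF y] by auto
    have "card (\<Union>t\<in>T y - B. ?S y t) \<le> (\<Sum>t\<in>T y - B. card (?S y t))"
      by (rule card_UN_le) (use memberD Ty in auto)
    also have "\<dots> \<le> (\<Sum>t\<in>T y - B. n ^ (d - s - 1))"
    proof (rule sum_mono)
      fix t assume t: "t \<in> T y - B"
      have "card (insert y (insert t B)) = s + 2"
        using t y Ty fB cB by (subst card_insert_disjoint) auto
      thus "card (?S y t) \<le> n ^ (d - s - 1)"
        using card_supersets_le[OF finite_V card_V, of "insert y (insert t B)" "d + 1"] fB by simp
    qed
    also have "\<dots> \<le> (d + 1) * n ^ (d - s - 1)"
      using card_mono[of "T y" "T y - B"] memberD[OF Ty(1)] by (simp del: mult_Suc add: mult_le_mono1)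
    finally show ?thesis .
  qed
  have "card {F \<in> \<F>. W F = B} \<le> card (\<Union>y\<in>F0 - B. \<Union>t\<in>T y - B. ?S y t)"
    by (rule card_mono[OF _ sub]) (auto simp: finite_V memberD T F0)
  also have "\<dots> \<le> (\<Sum>y\<in>F0 - B. card (\<Union>t\<in>T y - B. ?S y t))"
    by (rule card_UN_le) (use memberD F0 in auto)
  also have "\<dots> \<le> (\<Sum>y\<in>F0 - B. (d + 1) * n ^ (d - s - 1))"
    by (rule sum_mono) (rule inner)
  also have "\<dots> \<le> (d + 1) * ((d + 1) * n ^ (d - s - 1))"
    using card_mono[of F0 "F0 - B"] memberD[OF F0(1)] by (simp del: mult_Suc add: mult_le_mono1)
  finally show ?thesis by (simp add: power2_eq_square algebra_simps)
next
  case True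
  thus ?thesis by (simp only: card.empty)
qed

text \<open>The number of witnesses stays as a factor: for the whole family it is bounded by
  \<open>n ^ s\<close>, but for the members avoiding a point the error must scale with their own
  witnesses.\<close>

lemma card_uncentred:
  "card {F \<in> \<F>. \<not> centred (W F)} \<le> card (W ` \<F>) * ((d + 1)\<^sup>2 * n ^ (d - s - 1))"
proof -
  have "card {F \<in> \<F>. \<not> centred (W F)} \<le> card (\<Union>B\<in>{B \<in> W ` \<F>. \<not> centred B}. {F \<in> \<F>. W F = B})"
    by (rule card_mono) (use finite_family in auto)
  also have "\<dots> \<le> (\<Sum>B\<in>{B \<in> W ` \<F>. \<not> centred B}. card {F \<in> \<F>. W F = B})"
    by (rule card_UN_le) (use finite_family in auto)
  also have "\<dots> \<le> (\<Sum>B\<in>{B \<in> W ` \<F>. \<not> centred B}. (d + 1)\<^sup>2 * n ^ (d - s - 1))"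
    by (rule sum_mono) (use card_uncentred_fibre in auto)
  also have "\<dots> \<le> card (W ` \<F>) * ((d + 1)\<^sup>2 * n ^ (d - s - 1))"
    using card_mono[of "W ` \<F>" "{B \<in> W ` \<F>. \<not> centred B}"] finite_family by simp
  finally show ?thesis .
qed

definition trunc :: "'a set \<Rightarrow> 'a set" where
  "trunc F = F - {centre (W F)}"

lemma truncD:
  assumes "F \<in> \<F>" "centred (W F)"
  shows "trunc F \<subseteq> V" "card (trunc F) = d" "W F \<subseteq> trunc F" "F = insert (centre (W F)) (trunc F)"
  using centreD[OF assms(2)] memberD[OF assms(1)] W_subset[OF assms(1)] assms(1)
  unfolding trunc_def by auto

text \<open>Since \<open>F\<close> contains \<open>B\<close>, it contains \<open>centre B\<close>,
  and the only point of \<open>F\<close> outside \<open>trunc F\<close> is the centre of its own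
  witness. This drives both the injectivity of \<open>trunc\<close> and the conflict between sets
  with different centres.\<close>

lemma trunc_centre_unique:
  assumes "F \<in> \<F>" "centred (W F)" "centred B" "B \<subseteq> trunc F" "centre B \<notin> trunc F"
  shows "centre B = centre (W F)"
  using centreD(3)[OF assms(3,1)] truncD(4)[OF assms(1,2)] assms(4,5) by blast

text \<open>The witness of \<open>F2\<close> survives in the common truncation while its centre lies
  outside, so both members lost the same point.\<close>

lemma inj_on_trunc: "inj_on trunc {F \<in> \<F>. centred (W F)}"
proof (rule inj_onI)
  fix F1 F2 assume "F1 \<in> {F \<in> \<F>. centred (W F)}" "F2 \<in> {F \<in> \<F>. centred (W F)}"
    and eq: "trunc F1 = trunc F2"
  hence F: "F1 \<in> \<F>" "centred (W F1)" "F2 \<in> \<F>" "centred (W F2)" by auto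
  have "centre (W F2) \<notin> trunc F2" by (simp add: trunc_def)
  hence "centre (W F2) = centre (W F1)"
    using trunc_centre_unique[OF F(1,2,4)] truncD(3)[OF F(3,4)] eq by simp
  thus "F1 = F2" using truncD(4)[OF F(1,2)] truncD(4)[OF F(3,4)] eq by simp
qed

section \<open>Sizes of the family and of the set of truncations\<close>

lemma card_witnesses_le: "card (W ` \<F>) \<le> n ^ s"
proof -
  have "card (W ` \<F>) \<le> card {X. X \<subseteq> V \<and> card X = s \<and> {} \<subseteq> X}"
    by (rule card_mono) (use finite_V W_subset card_W memberD(1) in \<open>auto, blast\<close>)
  also have "\<dots> \<le> n ^ s"
    using card_supersets_le[OF finite_V card_V, of "{}" s] by simp
  finally show ?thesis .
qed

lemma card_family_split: "card \<F> = card {F \<in> \<F>. Q F} + card {F \<in> \<F>. \<not> Q F}"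
proof -
  have "card \<F> = card ({F \<in> \<F>. Q F} \<union> {F \<in> \<F>. \<not> Q F})"
    by (rule arg_cong[where f = card]) auto
  also have "\<dots> = card {F \<in> \<F>. Q F} + card {F \<in> \<F>. \<not> Q F}"
    by (rule card_Un_disjoint) (use finite_family in auto)
  finally show ?thesis .
qed

lemma card_family_le:
  "card \<F> \<le> card {F \<in> \<F>. centred (W F)} + card (W ` \<F>) * ((d + 1)\<^sup>2 * n ^ (d - s - 1))"
  using card_uncentred card_family_split[of "\<lambda>F. centred (W F)"] by linarith

lemma card_meeting_le:
  assumes "finite A" "Bs \<subseteq> {B. B \<subseteq> V \<and> card B = s}"
  shows "card {B \<in> Bs. A \<inter> B \<noteq> {}} \<le> card A * n ^ (s - 1)"
proof -
  have "card {B \<in> Bs. A \<inter> B \<noteq> {}} \<le> card (\<Union>a\<in>A. {X. X \<subseteq> V \<and> card X = s \<and> {a} \<subseteq> X})"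
    by (rule card_mono) (use assms finite_V in auto)
  also have "\<dots> \<le> (\<Sum>a\<in>A. card {X. X \<subseteq> V \<and> card X = s \<and> {a} \<subseteq> X})"
    by (rule card_UN_le) (use assms in auto)
  also have "\<dots> \<le> (\<Sum>a\<in>A. n ^ (s - 1))"
    using card_supersets_le[OF finite_V card_V, of "{a}" s for a] by (intro sum_mono) simp
  finally show ?thesis by simp
qed

lemma card_non_trunc:
  assumes "(n - 1) choose d \<le> card \<F>" "1 \<le> n"
  shows "card ({G. G \<subseteq> V \<and> card G = d} - trunc ` {F \<in> \<F>. centred (W F)})
    \<le> ((d + 1)\<^sup>2 + 1) * n ^ (d - 1)"
    and "(n - 1) choose d \<le> card (trunc ` {F \<in> \<F>. centred (W F)}) + (d + 1)\<^sup>2 * n ^ (d - 1)"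
proof -
  let ?D = "{G. G \<subseteq> V \<and> card G = d}" and ?I = "trunc ` {F \<in> \<F>. centred (W F)}"
  have "card (W ` \<F>) * ((d + 1)\<^sup>2 * n ^ (d - s - 1)) \<le> n ^ s * ((d + 1)\<^sup>2 * n ^ (d - s - 1))"
    by (rule mult_le_mono1) (rule card_witnesses_le)
  also have "\<dots> = (d + 1)\<^sup>2 * (n ^ (s + (d - s - 1)))"
    by (simp only: power_add ac_simps)
  also have "s + (d - s - 1) = d - 1" using s_pos two_s by simp
  finally have "card (W ` \<F>) * ((d + 1)\<^sup>2 * n ^ (d - s - 1)) \<le> (d + 1)\<^sup>2 * n ^ (d - 1)" .
  moreover have "card ?I = card {F \<in> \<F>. centred (W F)}"
    by (rule card_image) (rule inj_on_trunc)
  ultimately show I: "(n - 1) choose d \<le> card ?I + (d + 1)\<^sup>2 * n ^ (d - 1)"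
    using card_family_le assms by linarith
  have sub: "?I \<subseteq> ?D" using truncD by auto
  have "card (?D - ?I) = card ?D - card ?I"
    by (rule card_Diff_subset[OF finite_subset[OF sub] sub]) (use finite_V in auto)
  moreover have "card ?D = n choose d" using n_subsets[OF finite_V] card_V by simp
  \<comment> \<open>By Pascal's rule the \<open>d\<close>-sets outnumber a star only by a term of
    order \<open>n ^ (d - 1)\<close>, the same order as the loss from uncentred witnesses.\<close>
  moreover have "n choose d = ((n - 1) choose d) + ((n - 1) choose (d - 1))"
    using choose_reduce_nat[of n d] assms(2) s_pos two_s by simp
  moreover have "(n - 1) choose (d - 1) \<le> n ^ (d - 1)"
  proof (cases "d - 1 \<le> n - 1")
    case True
    have "(n - 1) choose (d - 1) \<le> (n - 1) ^ (d - 1)" using True by (rule binomial_le_pow)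
    also have "\<dots> \<le> n ^ (d - 1)" by (rule power_mono) auto
    finally show ?thesis .
  qed (simp add: binomial_eq_0)
  ultimately show "card (?D - ?I) \<le> ((d + 1)\<^sup>2 + 1) * n ^ (d - 1)"
    using I by (simp only: add_mult_distrib) linarith
qed

section \<open>A dense class of sets with a common centre\<close>

text \<open>Among the \<open>b * b\<close> ordered pairs of centred \<open>s\<close>-sets, those in
  general position with different centres are few, because they force many \<open>d\<close>-sets not
  to be truncations, and overlapping pairs are few as well. So most pairs share a centre, which is
  impossible if every class is small. \<open>E\<close> is such a class: a member containing one of
  its sets contains \<open>x\<close>.\<close>

lemma large_colour_class:
  fixes c K C :: real
  assumes K: "K = (real d + 1)\<^sup>2" and c: "c = 1 / (2 * real (2 * d) ^ d)"
    and C: "C = real (8 * d) ^ d * (K + 1)"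
    and big: "(n - 1) choose d \<le> card \<F>"
    and n1: "2 * (d + 2) \<le> n" and n2: "K / c \<le> real n"
    and n3: "(2 / c) * (C / c + 2 * (real s + 1)) < real n"
  shows "\<exists>x\<in>V. \<exists>E. E \<subseteq> {B. B \<subseteq> V \<and> card B = s \<and> x \<notin> B} \<and>
    (\<forall>F\<in>\<F>. x \<notin> F \<longrightarrow> (\<forall>B\<in>E. \<not> B \<subseteq> F)) \<and> c / 2 * real n ^ s \<le> real (card E)"
proof (rule ccontr)
  assume contra: "\<not> ?thesis"
  define Bs where "Bs = {B. B \<subseteq> V \<and> card B = s \<and> centred B}"
  define I where "I = trunc ` {F \<in> \<F>. centred (W F)}"
  define N where "N = {G. G \<subseteq> V \<and> card G = d} - I"
  define b where "b = real (card Bs)"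
  have d: "1 \<le> d" using s_pos two_s by simp
  have n0: "0 < real n" using n1 by simp
  have c0: "0 < c" using c d by simp
  have C0: "0 \<le> C" using C K by simp
  have finB: "finite Bs" unfolding Bs_def using finite_V by simp
  have N_le: "real (card N) \<le> (K + 1) * real n ^ (d - 1)"
  proof -
    have "real (card N) \<le> real (((d + 1)\<^sup>2 + 1) * n ^ (d - 1))"
      unfolding N_def I_def of_nat_le_iff by (rule card_non_trunc) (use big n1 in auto)
    thus ?thesis by (simp add: K algebra_simps)
  qed
  have I_le: "card I \<le> card Bs * n ^ (d - s)"
  proof -
    have "card I \<le> card (\<Union>B\<in>Bs. {X. X \<subseteq> V \<and> card X = d \<and> B \<subseteq> X})"
    proof (rule card_mono)
      show "I \<subseteq> (\<Union>B\<in>Bs. {X. X \<subseteq> V \<and> card X = d \<and> B \<subseteq> X})"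
      proof
        fix X assume "X \<in> I"
        then obtain F where F: "F \<in> \<F>" "centred (W F)" "X = trunc F" by (auto simp: I_def)
        have "W F \<in> Bs"
          using F(2) card_W[OF F(1)] W_subset[OF F(1)] memberD(1)[OF F(1)] by (auto simp: Bs_def)
        thus "X \<in> (\<Union>B\<in>Bs. {X. X \<subseteq> V \<and> card X = d \<and> B \<subseteq> X})"
          using truncD[OF F(1,2)] F(3) by blast
      qed
    qed (use finB finite_V in auto)
    also have "\<dots> \<le> (\<Sum>B\<in>Bs. card {X. X \<subseteq> V \<and> card X = d \<and> B \<subseteq> X})"
      by (rule card_UN_le) (rule finB)
    also have "\<dots> \<le> (\<Sum>B\<in>Bs. n ^ (d - s))"
    proof (rule sum_mono)
      fix B assume "B \<in> Bs"
      hence "finite B" "card B = s" using finite_V finite_subset by (auto simp: Bs_def)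
      thus "card {X. X \<subseteq> V \<and> card X = d \<and> B \<subseteq> X} \<le> n ^ (d - s)"
        using card_supersets_le[OF finite_V card_V, of B d] by simp
    qed
    finally show ?thesis by simp
  qed
  have b_ge: "c * real n ^ s \<le> b"
  proof -
    \<comment> \<open>\<open>c\<close> is half the constant in the lower bound of order
      \<open>n ^ d\<close> for the size of a star.\<close>
    have "2 * c * real n ^ d = (real n / real (2 * d)) ^ d"
      by (simp add: c power_divide)
    also have "\<dots> \<le> (real (n - 1) / real d) ^ d"
    proof (rule power_mono)
      have "real n / real (2 * d) \<le> real (2 * (n - 1)) / real (2 * d)"
        by (rule divide_right_mono) (use n1 in auto)
      thus "real n / real (2 * d) \<le> real (n - 1) / real d" by simp
    qed simp
    also have "\<dots> \<le> real ((n - 1) choose d)"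
      by (rule binomial_ge_n_over_k_pow_k) (use n1 in auto)
    also have "\<dots> \<le> real (card I + (d + 1)\<^sup>2 * n ^ (d - 1))"
      unfolding of_nat_le_iff I_def by (rule card_non_trunc) (use big n1 in auto)
    also have "\<dots> \<le> real (card Bs * n ^ (d - s)) + K * real n ^ (d - 1)"
    proof -
      have "real (card I) \<le> real (card Bs * n ^ (d - s))"
        using I_le by (rule of_nat_mono)
      moreover have "real ((d + 1)\<^sup>2 * n ^ (d - 1)) = K * real n ^ (d - 1)"
        by (simp add: K add.commute)
      ultimately show ?thesis by (simp only: of_nat_add add_right_mono)
    qed
    \<comment> \<open>By \<open>n2\<close> the uncentred members cost at most half of
      \<open>2 * c * n ^ d\<close>.\<close>
    also have "K * real n ^ (d - 1) \<le> (c * real n) * real n ^ (d - 1)"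
      by (rule mult_right_mono) (use n2 c0 in \<open>auto simp: field_simps\<close>)
    also have "\<dots> = c * real n ^ d"
      using d by (cases d) auto
    finally have "c * real n ^ d \<le> b * real n ^ (d - s)" by (simp add: b_def)
    moreover have "real n ^ d = real n ^ s * real n ^ (d - s)"
      using two_s by (simp flip: power_add)
    ultimately show ?thesis using n0 by (simp flip: mult.assoc)
  qed
  have b0: "0 < b" using b_ge c0 n0 by (smt (verit) mult_pos_pos zero_less_power)
  define P where "P = {(A, B) \<in> Bs \<times> Bs. A \<inter> B = {} \<and> centre A \<noteq> centre B \<and> centre A \<notin> B \<and> centre B \<notin> A}"
  define Q where "Q = (SIGMA A:Bs. {B \<in> Bs. insert (centre A) A \<inter> B \<noteq> {}})"
  define S where "S = (SIGMA A:Bs. {B \<in> Bs. centre B = centre A})"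
  have P_le: "real (card P) \<le> C * real n ^ (2 * s - 1)"
  proof -
    have "real (card P) * real n ^ (d - 2 * s) \<le> real (8 * d) ^ d * real (card N)"
    proof (rule card_disjoint_pairs_le[OF finite_V card_V two_s n1, where T = "\<lambda>A B. {centre A, centre B}"])
      fix A B assume AB: "(A, B) \<in> P"
      thus "A \<subseteq> V \<and> B \<subseteq> V \<and> card A = s \<and> card B = s \<and> A \<inter> B = {}"
        by (auto simp: P_def Bs_def)
      show "finite {centre A, centre B} \<and> card {centre A, centre B} \<le> 2 \<and> (A \<union> B) \<inter> {centre A, centre B} = {}"
        using AB centreD(2) by (auto simp: P_def Bs_def card_insert_if)
      fix G assume G: "G \<subseteq> V" "card G = d" "A \<union> B \<subseteq> G" "G \<inter> {centre A, centre B} = {}"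
      \<comment> \<open>Otherwise both centres would equal the single point deleted to form
        \<open>G\<close>.\<close>
      have "G \<notin> I"
      proof
        assume "G \<in> I"
        then obtain F where F: "F \<in> \<F>" "centred (W F)" "G = trunc F" by (auto simp: I_def)
        have "centre A = centre (W F)" "centre B = centre (W F)"
          by (rule trunc_centre_unique[OF F(1,2)]; use AB G F(3) in \<open>auto simp: P_def Bs_def\<close>)+
        thus False using AB by (auto simp: P_def)
      qed
      thus "G \<in> N" using G by (simp add: N_def)
    qed (simp add: N_def)
    also have "\<dots> \<le> real (8 * d) ^ d * ((K + 1) * real n ^ (d - 1))"
      by (rule mult_left_mono[OF N_le]) simp
    also have "\<dots> = C * real n ^ (2 * s - 1 + (d - 2 * s))"
      using s_pos two_s by (simp add: C)
    finally show ?thesis using n0 by (simp add: power_add flip: mult.assoc)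
  qed
  have Q_le: "real (card Q) \<le> b * ((real s + 1) * real n ^ (s - 1))"
  proof -
    have "card Q = (\<Sum>A\<in>Bs. card {B \<in> Bs. insert (centre A) A \<inter> B \<noteq> {}})"
      unfolding Q_def by (rule card_SigmaI) (use finB in auto)
    also have "\<dots> \<le> (\<Sum>A\<in>Bs. (s + 1) * n ^ (s - 1))"
    proof (rule sum_mono)
      fix A assume A: "A \<in> Bs"
      hence fA: "finite A" and "card A = s" using finite_V finite_subset by (auto simp: Bs_def)
      hence "card (insert (centre A) A) \<le> s + 1" by (simp add: card_insert_if)
      moreover have "card {B \<in> Bs. insert (centre A) A \<inter> B \<noteq> {}} \<le> card (insert (centre A) A) * n ^ (s - 1)"
        by (rule card_meeting_le) (use fA in \<open>auto simp: Bs_def\<close>)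
      ultimately show "card {B \<in> Bs. insert (centre A) A \<inter> B \<noteq> {}} \<le> (s + 1) * n ^ (s - 1)"
        by (meson le_trans mult_le_mono1)
    qed
    also have "\<dots> = card Bs * ((s + 1) * n ^ (s - 1))" by simp
    finally have "real (card Q) \<le> real (card Bs * ((s + 1) * n ^ (s - 1)))" by (rule of_nat_mono)
    thus ?thesis by (simp add: b_def algebra_simps)
  qed
  have S_le: "real (card S) \<le> b * (c / 2 * real n ^ s)"
  proof -
    have "real (card S) = (\<Sum>A\<in>Bs. real (card {B \<in> Bs. centre B = centre A}))"
      unfolding S_def using finB by (simp add: card_SigmaI)
    also have "\<dots> \<le> (\<Sum>A\<in>Bs. c / 2 * real n ^ s)"
    proof (rule sum_mono)
      fix A assume A: "A \<in> Bs"
      let ?E = "{B \<in> Bs. centre B = centre A}"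
      have "centre A \<in> V" using A centreD(1) by (simp add: Bs_def)
      moreover have "?E \<subseteq> {B. B \<subseteq> V \<and> card B = s \<and> centre A \<notin> B}"
        using centreD(2) by (force simp: Bs_def)
      moreover have "\<forall>F\<in>\<F>. centre A \<notin> F \<longrightarrow> (\<forall>B\<in>?E. \<not> B \<subseteq> F)"
        using centreD(3) by (force simp: Bs_def)
      ultimately have "\<not> c / 2 * real n ^ s \<le> real (card ?E)"
        using contra by blast
      thus "real (card ?E) \<le> c / 2 * real n ^ s" by simp
    qed
    finally show ?thesis by (simp add: b_def)
  qed
  have fin: "finite P" "finite Q" "finite S"
    by (rule finite_subset[of _ "Bs \<times> Bs"]; use finB in \<open>auto simp: P_def Q_def S_def\<close>)+
  \<comment> \<open>The converse of \<open>Q\<close> takes the pairs with \<open>centre B\<close> in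
    \<open>A\<close>; any other failure of the conditions in \<open>P\<close> falls into
    \<open>Q\<close> or \<open>S\<close>.\<close>
  have "Bs \<times> Bs \<subseteq> P \<union> Q \<union> Q\<inverse> \<union> S"
    by (auto simp: P_def Q_def S_def)
  hence "card (Bs \<times> Bs) \<le> card (P \<union> Q \<union> Q\<inverse> \<union> S)"
    by (rule card_mono[rotated]) (use fin in auto)
  also have "\<dots> \<le> card P + card Q + card (Q\<inverse>) + card S"
    by (meson card_Un_le add_le_mono1 le_trans)
  finally have "real (card Bs * card Bs) \<le> real (card P + card Q + card Q + card S)"
    by (simp only: card_inverse of_nat_le_iff card_cartesian_product)
  hence "b * b \<le> real (card P) + 2 * real (card Q) + real (card S)"
    by (simp add: b_def)
  also have "\<dots> \<le> C * real n ^ (2 * s - 1) + 2 * (b * ((real s + 1) * real n ^ (s - 1))) + b * (c / 2 * real n ^ s)"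
    using P_le Q_le S_le by linarith
  \<comment> \<open>Spending one factor \<open>c * n ^ s \<le> b\<close> makes this term a multiple
    of \<open>b\<close>, so that \<open>b\<close> cancels from the bound on
    \<open>b * b\<close>.\<close>
  also have "C * real n ^ (2 * s - 1) \<le> b * (C / c * real n ^ (s - 1))"
  proof -
    have "2 * s - 1 = s + (s - 1)" using s_pos by simp
    hence "C * real n ^ (2 * s - 1) = (c * real n ^ s) * (C / c * real n ^ (s - 1))"
      using c0 by (simp add: power_add)
    also have "\<dots> \<le> b * (C / c * real n ^ (s - 1))"
      by (rule mult_right_mono[OF b_ge]) (use C0 c0 in simp)
    finally show ?thesis .
  qed
  finally have "b * b \<le> b * ((C / c + 2 * (real s + 1)) * real n ^ (s - 1) + c / 2 * real n ^ s)"
    by (simp add: algebra_simps)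
  hence "b \<le> (C / c + 2 * (real s + 1)) * real n ^ (s - 1) + c / 2 * real n ^ s"
    using b0 by simp
  \<comment> \<open>Half of the left side now survives against a term of order
    \<open>n ^ (s - 1)\<close>, which \<open>n3\<close> rules out.\<close>
  hence "c * real n ^ s \<le> (C / c + 2 * (real s + 1)) * real n ^ (s - 1) + c / 2 * real n ^ s"
    using b_ge by linarith
  hence "(c / 2 * real n) * real n ^ (s - 1) \<le> (C / c + 2 * (real s + 1)) * real n ^ (s - 1)"
    using s_pos by (cases s) (auto simp: field_simps)
  hence "c / 2 * real n \<le> C / c + 2 * (real s + 1)"
    using n0 by simp
  hence "real n \<le> (2 / c) * (C / c + 2 * (real s + 1))"
    using c0 by (simp add: field_simps)
  thus False using n3 by simp
qed

section \<open>Comparing a non-star with the star at \<open>x\<close>\<close>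

text \<open>The members through \<open>x\<close> fall short of a full star by \<open>card M\<close>,
  which is nearly \<open>card U\<close> (\<open>missing\<close>), while the members avoiding
  \<open>x\<close> number little more than \<open>card (U - U1)\<close> (\<open>outside\<close>).
  The net deficit is \<open>card U1\<close> minus the errors, and \<open>gain\<close> makes
  \<open>U1\<close> larger than these by a factor of order \<open>n\<close>.\<close>

lemma not_star_imp_small:
  fixes \<delta> :: real
  assumes x: "x \<in> V" and E: "E \<subseteq> {B. B \<subseteq> V \<and> card B = s \<and> x \<notin> B}"
    and E_avoid: "\<And>F B. F \<in> \<F> \<Longrightarrow> x \<notin> F \<Longrightarrow> B \<in> E \<Longrightarrow> \<not> B \<subseteq> F"
    and \<delta>: "0 < \<delta>" "\<delta> * real n ^ s \<le> real (card E)"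
    and F0: "F0 \<in> \<F>" "x \<notin> F0"
    and n1: "2 * (d + 2) \<le> n" and n2: "2 * real s / \<delta> \<le> real n"
    and n3: "((real d + 1)\<^sup>2 + real d + 1) * (2 * real (8 * d) ^ d / \<delta>) < real n"
  shows "card \<F> < (n - 1) choose d"
proof -
  define Fo where "Fo = {F \<in> \<F>. x \<notin> F}"
  \<comment> \<open>Centres are recomputed within \<open>Fo\<close>: truncations then avoid
    \<open>x\<close>, and the errors scale with the number \<open>b\<close> of witnesses of
    \<open>Fo\<close>.\<close>
  interpret o: witness_family V Fo W d s n
    by unfold_locales
      (use finite_V card_V members W_subset card_W W_avoid s_pos two_s in \<open>auto simp: Fo_def\<close>)
  define Wo where "Wo = W ` Fo"
  define b where "b = card Wo"
  define U where "U = {G. G \<subseteq> V - {x} \<and> card G = d \<and> (\<exists>B\<in>Wo. B \<subseteq> G)}"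
  define U1 where "U1 = {G \<in> U. \<exists>B\<in>E. B \<subseteq> G}"
  define M where "M = {G. G \<subseteq> V - {x} \<and> card G = d \<and> insert x G \<notin> \<F>}"
  have n0: "0 < real n" and d: "1 \<le> d" using n1 s_pos two_s by auto
  have finU: "finite U" and finM: "finite M" using finite_V by (auto simp: U_def M_def)
  have finWo: "finite Wo" using o.finite_family by (simp add: Wo_def)
  have Wo: "B \<subseteq> V" "card B = s" "finite B" "x \<notin> B" if "B \<in> Wo" for B
  proof -
    obtain F where "F \<in> Fo" "B = W F" using \<open>B \<in> Wo\<close> by (auto simp: Wo_def)
    thus "B \<subseteq> V" "card B = s" "finite B" "x \<notin> B"
      using o.memberD[of F] o.W_subset[of F] o.card_W[of F] by (auto simp: Fo_def)
  qed
  have b0: "0 < b"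
    using finWo F0 by (auto simp: b_def Wo_def Fo_def card_gt_0_iff)
  have outside: "card Fo \<le> card (U - U1) + b * ((d + 1)\<^sup>2 * n ^ (d - s - 1))"
  proof -
    have "o.trunc F \<in> U - U1" if F: "F \<in> Fo" "o.centred (W F)" for F
    proof -
      have sub: "o.trunc F \<subseteq> F" by (auto simp: o.trunc_def)
      have "o.trunc F \<in> U"
        using o.truncD[OF F] sub F(1) by (auto simp: U_def Wo_def Fo_def)
      \<comment> \<open>A truncation in \<open>U1\<close> would place a set of \<open>E\<close>
        inside a member avoiding \<open>x\<close>.\<close>
      moreover have "\<not> B \<subseteq> o.trunc F" if "B \<in> E" for B
        using E_avoid[of F B] that F(1) sub by (auto simp: Fo_def)
      ultimately show ?thesis by (auto simp: U1_def)
    qed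
    hence "card {F \<in> Fo. o.centred (W F)} \<le> card (U - U1)"
      by (intro card_inj_on_le[OF o.inj_on_trunc]) (use finU in auto)
    thus ?thesis using o.card_family_le unfolding b_def Wo_def by linarith
  qed
  have star: "card {F \<in> \<F>. x \<in> F} + card M \<le> (n - 1) choose d"
  proof -
    let ?L = "{G. G \<subseteq> V - {x} \<and> card G = d}"
    have "card {F \<in> \<F>. x \<in> F} \<le> card (?L - M)"
    proof (rule card_inj_on_le[where f = "\<lambda>F. F - {x}"])
      show "inj_on (\<lambda>F. F - {x}) {F \<in> \<F>. x \<in> F}" by (auto simp: inj_on_def)
      show "(\<lambda>F. F - {x}) ` {F \<in> \<F>. x \<in> F} \<subseteq> ?L - M"
        using memberD by (auto simp: M_def insert_absorb)
    qed (use finite_V in auto)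
    moreover have "card (?L - M) = card ?L - card M" "card M \<le> card ?L"
      using finite_V finM by (auto simp: M_def intro!: card_Diff_subset card_mono)
    moreover have "card ?L = (n - 1) choose d"
      using finite_V card_V x by (simp add: n_subsets)
    ultimately show ?thesis by linarith
  qed
  have missing: "card U \<le> card M + b * ((d + 1) * n ^ (d - s - 1))"
  proof -
    have "\<forall>B\<in>Wo. \<exists>F. F \<in> Fo \<and> W F = B" by (auto simp: Wo_def)
    then obtain R where R: "\<And>B. B \<in> Wo \<Longrightarrow> R B \<in> Fo \<and> W (R B) = B" by metis
    let ?S = "\<lambda>B t. {X. X \<subseteq> V \<and> card X = d \<and> insert t B \<subseteq> X}"
    have "U - M \<subseteq> (\<Union>B\<in>Wo. \<Union>t\<in>R B - B. ?S B t)"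
    proof
      fix G assume "G \<in> U - M"
      then obtain B where G: "G \<subseteq> V - {x}" "card G = d" "B \<in> Wo" "B \<subseteq> G" "insert x G \<in> \<F>"
        by (auto simp: U_def M_def)
      have "R B \<in> \<F>" "x \<notin> R B" "W (R B) = B" "B \<subseteq> R B"
        using R[OF G(3)] W_subset[of "R B"] by (auto simp: Fo_def)
      \<comment> \<open>\<open>R B\<close> has witness \<open>B\<close>, so it meets
        \<open>insert x G\<close> outside \<open>B\<close>; as \<open>x\<close> is not in
        \<open>R B\<close>, the common point lies in \<open>G\<close>.\<close>
      then obtain t where "t \<in> R B - B" "t \<in> G"
        using W_avoid[of "R B" "insert x G"] G(4,5) by blast
      thus "G \<in> (\<Union>B\<in>Wo. \<Union>t\<in>R B - B. ?S B t)" using G by blast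
    qed
    hence "card (U - M) \<le> card (\<Union>B\<in>Wo. \<Union>t\<in>R B - B. ?S B t)"
      by (rule card_mono[rotated]) (use finWo finite_V R o.memberD in auto)
    also have "\<dots> \<le> (\<Sum>B\<in>Wo. card (\<Union>t\<in>R B - B. ?S B t))"
      by (rule card_UN_le) (rule finWo)
    also have "\<dots> \<le> (\<Sum>B\<in>Wo. (d + 1) * n ^ (d - s - 1))"
    proof (rule sum_mono)
      fix B assume B: "B \<in> Wo"
      have RB: "finite (R B)" "card (R B) = d + 1" using R[OF B] o.memberD by auto
      have "card (\<Union>t\<in>R B - B. ?S B t) \<le> (\<Sum>t\<in>R B - B. card (?S B t))"
        by (rule card_UN_le) (use RB in auto)
      also have "\<dots> \<le> (\<Sum>t\<in>R B - B. n ^ (d - s - 1))"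
      proof (rule sum_mono)
        fix t assume "t \<in> R B - B"
        hence "card (insert t B) = s + 1" using Wo[OF B] by simp
        thus "card (?S B t) \<le> n ^ (d - s - 1)"
          using card_supersets_le[OF finite_V card_V, of "insert t B" d] Wo[OF B] by simp
      qed
      also have "\<dots> \<le> (d + 1) * n ^ (d - s - 1)"
        using card_mono[of "R B" "R B - B"] RB by (simp del: mult_Suc add: mult_le_mono1)
      finally show "card (\<Union>t\<in>R B - B. ?S B t) \<le> (d + 1) * n ^ (d - s - 1)" .
    qed
    finally have "card (U - M) \<le> b * ((d + 1) * n ^ (d - s - 1))" by (simp add: b_def)
    moreover have "card U \<le> card M + card (U - M)"
      using card_Un_le[of M "U - M"] card_mono[of "M \<union> (U - M)" U] finM finU by auto
    ultimately show ?thesis by linarith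
  qed
  have gain: "real b * (\<delta> / 2) * real n ^ (d - s) \<le> real (8 * d) ^ d * real (card U1)"
  proof -
    \<comment> \<open>A \<open>d\<close>-set avoiding \<open>x\<close> that contains both sets of
      such a pair lies in \<open>U1\<close>, so the double count applies with forbidden set
      \<open>{x}\<close>.\<close>
    define P where "P = (SIGMA A:Wo. {B \<in> E. A \<inter> B = {}})"
    have finE: "finite E" by (rule finite_subset[OF E]) (use finite_V in auto)
    have "real b * (\<delta> / 2 * real n ^ s) = (\<Sum>A\<in>Wo. \<delta> / 2 * real n ^ s)"
      by (simp add: b_def)
    also have "\<dots> \<le> (\<Sum>A\<in>Wo. real (card {B \<in> E. A \<inter> B = {}}))"
    proof (rule sum_mono)
      fix A assume A: "A \<in> Wo"
      have "card {B \<in> E. A \<inter> B \<noteq> {}} \<le> s * n ^ (s - 1)"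
        using card_meeting_le[of A E] Wo[OF A] E by auto
      moreover have "card E = card {B \<in> E. A \<inter> B = {}} + card {B \<in> E. A \<inter> B \<noteq> {}}"
        using finE by (subst card_Un_disjoint[symmetric]) (auto intro!: arg_cong[where f = card])
      ultimately have "card E \<le> card {B \<in> E. A \<inter> B = {}} + s * n ^ (s - 1)" by linarith
      hence "real (card E) \<le> real (card {B \<in> E. A \<inter> B = {}} + s * n ^ (s - 1))"
        by (rule of_nat_mono)
      hence "\<delta> * real n ^ s \<le> real (card {B \<in> E. A \<inter> B = {}}) + real s * real n ^ (s - 1)"
        using \<delta>(2) by simp
      \<comment> \<open>By \<open>n2\<close> the sets of \<open>E\<close> meeting \<open>A\<close>
        use up at most half of the density.\<close>
      moreover have "real s * real n ^ (s - 1) \<le> (\<delta> / 2 * real n) * real n ^ (s - 1)"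
        by (rule mult_right_mono) (use n2 \<delta>(1) in \<open>auto simp: field_simps\<close>)
      moreover have "\<dots> = \<delta> / 2 * real n ^ s" using s_pos by (cases s) auto
      ultimately show "\<delta> / 2 * real n ^ s \<le> real (card {B \<in> E. A \<inter> B = {}})" by linarith
    qed
    also have "\<dots> = real (card P)"
      unfolding P_def using finWo finE by (simp add: card_SigmaI)
    finally have P_ge: "real b * (\<delta> / 2 * real n ^ s) \<le> real (card P)" .
    have P_le: "real (card P) * real n ^ (d - 2 * s) \<le> real (8 * d) ^ d * real (card U1)"
    proof (rule card_disjoint_pairs_le[OF finite_V card_V two_s n1, where T = "\<lambda>A B. {x}"])
      fix A B assume AB: "(A, B) \<in> P"
      thus "A \<subseteq> V \<and> B \<subseteq> V \<and> card A = s \<and> card B = s \<and> A \<inter> B = {}"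
        using Wo E by (auto simp: P_def)
      show "finite {x} \<and> card {x} \<le> 2 \<and> (A \<union> B) \<inter> {x} = {}"
        using AB Wo E by (auto simp: P_def)
      fix G assume "G \<subseteq> V" "card G = d" "A \<union> B \<subseteq> G" "G \<inter> {x} = {}"
      thus "G \<in> U1" using AB by (auto simp: P_def U1_def U_def)
    qed (auto simp: U1_def U_def)
    have "s + (d - 2 * s) = d - s" using two_s by simp
    hence "real b * (\<delta> / 2) * real n ^ (d - s)
      = real b * (\<delta> / 2 * real n ^ s) * real n ^ (d - 2 * s)"
      by (simp flip: power_add mult.assoc)
    also have "\<dots> \<le> real (card P) * real n ^ (d - 2 * s)"
      by (rule mult_right_mono[OF P_ge]) simp
    finally show ?thesis using P_le by linarith
  qed
  \<comment> \<open>The error constant combines \<open>(d + 1)\<^sup>2\<close> from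
    \<open>outside\<close> with \<open>d + 1\<close> from \<open>missing\<close>;
    \<open>gain\<close> has one more power of \<open>n\<close>, and \<open>n3\<close> makes it
    prevail.\<close>
  have "b * (((d + 1)\<^sup>2 + d + 1) * n ^ (d - s - 1)) < card U1"
  proof -
    let ?K = "(real d + 1)\<^sup>2 + real d + 1" and ?C = "real (8 * d) ^ d"
    have C0: "0 < ?C" using d by simp
    have "?C * (real b * (?K * real n ^ (d - s - 1))) = real b * real n ^ (d - s - 1) * (?C * ?K)"
      by simp
    also have "?C * ?K < \<delta> / 2 * real n"
      using n3 \<delta>(1) by (simp add: field_simps)
    hence "real b * real n ^ (d - s - 1) * (?C * ?K) < real b * real n ^ (d - s - 1) * (\<delta> / 2 * real n)"
      by (rule mult_strict_left_mono) (use b0 n0 in simp)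
    also have "\<dots> = real b * (\<delta> / 2) * real n ^ Suc (d - s - 1)" by simp
    also have "Suc (d - s - 1) = d - s" using s_pos two_s by simp
    also note gain
    finally have "real b * (?K * real n ^ (d - s - 1)) < real (card U1)"
      by (simp only: mult_less_cancel_left_pos[OF C0])
    hence "real (b * (((d + 1)\<^sup>2 + d + 1) * n ^ (d - s - 1))) < real (card U1)"
      by (simp add: algebra_simps)
    thus ?thesis by (simp only: of_nat_less_iff)
  qed
  moreover have "card U = card (U - U1) + card U1"
    using card_Diff_subset[of U1 U] card_mono[of U U1] finU
    by (auto simp: U1_def)
  moreover have "card \<F> = card {F \<in> \<F>. x \<in> F} + card Fo"
    using card_family_split[of "\<lambda>F. x \<in> F"] by (simp add: Fo_def)
  ultimately show ?thesis
    using outside star missing by (simp only: add_mult_distrib add_mult_distrib2 mult_1)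
qed

end

section \<open>The threshold and the final dichotomy\<close>

theorem theorem1p4:
  fixes d s :: nat
  assumes "1 \<le> s" and "2 * s \<le> d"
  shows "\<exists>n0. \<forall>n \<ge> n0. \<forall>\<F>. s_witness_family n d s \<F> \<longrightarrow>
           card \<F> \<le> (n - 1) choose d \<and>
           (card \<F> = (n - 1) choose d \<longrightarrow> (\<exists>x\<in>{1..n}. \<forall>F\<in>\<F>. x \<in> F))"
proof -
  define K :: real where "K = (real d + 1)\<^sup>2"
  define c :: real where "c = 1 / (2 * real (2 * d) ^ d)"
  define C :: real where "C = real (8 * d) ^ d * (K + 1)"
  have c0: "0 < c / 2" using assms by (simp add: c_def)
  define t1 where "t1 = K / c"
  define t2 where "t2 = (2 / c) * (C / c + 2 * (real s + 1))"
  define t3 where "t3 = 2 * real s / (c / 2)"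
  define t4 where "t4 = ((real d + 1)\<^sup>2 + real d + 1) * (2 * real (8 * d) ^ d / (c / 2))"
  \<comment> \<open>\<open>t1\<close> and \<open>t2\<close> serve \<open>large_colour_class\<close>,
    \<open>t3\<close> and \<open>t4\<close> serve \<open>not_star_imp_small\<close> with density
    \<open>c / 2\<close>. The \<open>+ 1\<close> makes the bounds strict, and
    \<open>2 * (d + 2)\<close> leaves room for two forbidden points.\<close>
  define n0 where "n0 = nat \<lceil>Max {t1, t2, t3, t4}\<rceil> + 1 + 2 * (d + 2)"
  show ?thesis
  proof (intro exI[of _ n0] allI impI)
    fix n :: nat and \<F>
    assume n: "n0 \<le> n" and wit: "s_witness_family n d s \<F>"
    have n1: "2 * (d + 2) \<le> n" using n by (simp add: n0_def)
    have "Max {t1, t2, t3, t4} < real n"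
      using n unfolding n0_def by linarith
    hence t: "t1 \<le> real n" "t2 < real n" "t3 \<le> real n" "t4 < real n" by auto
    have "\<forall>F\<in>\<F>. \<exists>B. B \<subseteq> F \<and> card B = s \<and> (\<forall>F'\<in>\<F>. F \<inter> F' \<noteq> B)"
      using wit by (simp add: s_witness_family_def)
    then obtain W where W: "\<forall>F\<in>\<F>. W F \<subseteq> F \<and> card (W F) = s \<and> (\<forall>F'\<in>\<F>. F \<inter> F' \<noteq> W F)"
      by metis
    interpret witness_family "{1..n}" \<F> W d s n
      by unfold_locales (use W wit assms in \<open>auto simp: s_witness_family_def\<close>)
    \<comment> \<open>Non-stars are strictly smaller, so this disjunction settles the bound and the
      case of equality together.\<close>
    have "(\<exists>x\<in>{1..n}. \<forall>F\<in>\<F>. x \<in> F) \<or> card \<F> < (n - 1) choose d"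
    proof (rule disjCI)
      assume not_small: "\<not> card \<F> < (n - 1) choose d"
      hence big: "(n - 1) choose d \<le> card \<F>" by simp
      obtain x E where x: "x \<in> {1..n}" and E: "E \<subseteq> {B. B \<subseteq> {1..n} \<and> card B = s \<and> x \<notin> B}"
        "\<forall>F\<in>\<F>. x \<notin> F \<longrightarrow> (\<forall>B\<in>E. \<not> B \<subseteq> F)" "c / 2 * real n ^ s \<le> real (card E)"
        using large_colour_class[OF K_def c_def C_def big n1] t(1,2) unfolding t1_def t2_def by blast
      have "x \<in> F" if F: "F \<in> \<F>" for F
      proof (rule ccontr)
        assume "x \<notin> F"
        hence "card \<F> < (n - 1) choose d"
          using not_star_imp_small[OF x E(1) _ c0 E(3) F _ n1] E(2) t(3,4)
          unfolding t3_def t4_def by blast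
        thus False using not_small by simp
      qed
      thus "\<exists>x\<in>{1..n}. \<forall>F\<in>\<F>. x \<in> F" using x by blast
    qed
    thus "card \<F> \<le> (n - 1) choose d \<and>
        (card \<F> = (n - 1) choose d \<longrightarrow> (\<exists>x\<in>{1..n}. \<forall>F\<in>\<F>. x \<in> F))"
    proof
      assume "\<exists>x\<in>{1..n}. \<forall>F\<in>\<F>. x \<in> F"
      then obtain x where x: "x \<in> {1..n}" "\<forall>F\<in>\<F>. x \<in> F" by blast
      have "card \<F> \<le> card {G. G \<subseteq> {1..n} - {x} \<and> card G = d}"
      proof (rule card_inj_on_le[where f = "\<lambda>F. F - {x}"])
        show "inj_on (\<lambda>F. F - {x}) \<F>" using x(2) by (auto simp: inj_on_def)
        show "(\<lambda>F. F - {x}) ` \<F> \<subseteq> {G. G \<subseteq> {1..n} - {x} \<and> card G = d}"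
          using memberD x(2) by auto
      qed simp
      also have "\<dots> = (n - 1) choose d" using x(1) by (simp add: n_subsets)
      finally show ?thesis using x by blast
    qed auto
  qed
qed

end
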